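(* Let $n\ge 2$. An operation $*:(\mathcal{K}^n_s)^2\to\mathcal{K}^n$ is projection covariant if and only if there is a $1$-unconditional compact convex set $M$ in $\mathbb{R}^2$ such that $$h_{K*L}(x)=h_M\big(h_K(x),h_L(x)\big)$$ for all $K,L\in\mathcal{K}^n_s$ and all $x\in\mathbb{R}^n$, or equivalently such that $$K*L=K\oplus_M L$$ for all $K,L\in\mathcal{K}^n_s$. Moreover, $M$ is uniquely determined by $*$.
   Context: $\mathcal{K}^n$ is the class of nonempty compact convex subsets of $\mathbb{R}^n$; $\mathcal{K}^n_s$ is the subclass of $o$-symmetric sets ($K=-K$). The support function of a nonempty compact convex set $K$ is $h_K(x)=\sup\{x\cdot y:y\in K\}$. A set in $\mathbb{R}^2$ is $1$-unconditional if it is symmetric with respect to each coordinate axis; $M$ is nonempty. Projection covariant: $(K*L)|S=(K|S)*(L|S)$ for all $K,L\in\mathcal{K}^n_s$ and every linear subspace $S$ of $\mathbb{R}^n$ of dimension $k$, $1\le k\le n-1$, where $X|S$ is the orthogonal projection of $X$ onto $S$ (as a subset of $\mathbb{R}^n$). $M$-addition: $K\oplus_M L=\{ax+by: x\in K,\ y\in L,\ (a,b)\in M\}$. *)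

theory Defs
  imports "HOL-Analysis.Analysis"
begin

definition convex_bodies :: "'a::euclidean_space set set" where
  "convex_bodies = {K. K \<noteq> {} \<and> compact K \<and> convex K}"

definition symmetric_bodies :: "'a::euclidean_space set set" where
  "symmetric_bodies = {K \<in> convex_bodies. K = uminus ` K}"

text \<open>The supremum is a real one, so this is meaningful for nonempty bounded \<open>K\<close> only.\<close>

definition support_function :: "'a::euclidean_space set \<Rightarrow> 'a \<Rightarrow> real" where
  "support_function K x = (SUP y\<in>K. x \<bullet> y)"

definition orth_proj :: "'a::euclidean_space set \<Rightarrow> 'a \<Rightarrow> 'a" where
  "orth_proj S x = (THE y. y \<in> S \<and> (\<forall>z\<in>S. orthogonal (x - y) z))"

lemma orth_proj_unique:
  assumes "subspace S" "y \<in> S" "\<And>z. z \<in> S \<Longrightarrow> orthogonal (x - y) z"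
  shows "orth_proj S x = y"
  unfolding orth_proj_def
proof (rule the_equality)
  show "y \<in> S \<and> (\<forall>z\<in>S. orthogonal (x - y) z)" using assms by blast
  fix w assume w: "w \<in> S \<and> (\<forall>z\<in>S. orthogonal (x - w) z)"
  then have "w - y \<in> S" using assms by (simp add: subspace_diff)
  then have "(x - y) \<bullet> (w - y) = 0" "(x - w) \<bullet> (w - y) = 0"
    using w assms(3) by (auto simp: orthogonal_def)
  then have "(w - y) \<bullet> (w - y) = 0" by (simp add: inner_diff_left)
  then show "w = y" by simp
qed

lemma orth_proj:
  assumes "subspace S"
  shows "orth_proj S x \<in> S" and "z \<in> S \<Longrightarrow> orthogonal (x - orth_proj S x) z"
proof -
  obtain y w where yw: "y \<in> span S" "\<And>v. v \<in> span S \<Longrightarrow> orthogonal w v" "x = y + w"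
    using orthogonal_subspace_decomp_exists[of S x] by metis
  have "y \<in> S" "\<And>v. v \<in> S \<Longrightarrow> orthogonal (x - y) v"
    using yw assms span_eq_iff[of S] by (metis, metis add_diff_cancel_left')
  then show "orth_proj S x \<in> S" "z \<in> S \<Longrightarrow> orthogonal (x - orth_proj S x) z"
    using orth_proj_unique[OF assms] by auto
qed

text \<open>An operation is a total function on sets; only its values on symmetric bodies matter.\<close>

definition projection_covariant ::
    "('a::euclidean_space set \<Rightarrow> 'a set \<Rightarrow> 'a set) \<Rightarrow> bool" where
  "projection_covariant star \<longleftrightarrow>
     (\<forall>K\<in>symmetric_bodies. \<forall>L\<in>symmetric_bodies. \<forall>S.
        subspace S \<and> 1 \<le> dim S \<and> dim S \<le> DIM('a) - 1 \<longrightarrow>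
        orth_proj S ` star K L = star (orth_proj S ` K) (orth_proj S ` L))"

text \<open>The plane is \<open>real \<times> real\<close>, with its Euclidean inner product.\<close>

definition unconditional :: "(real \<times> real) set \<Rightarrow> bool" where
  "unconditional M \<longleftrightarrow> (\<lambda>(a, b). (a, - b)) ` M = M \<and> (\<lambda>(a, b). (- a, b)) ` M = M"

definition M_sum ::
    "'a::real_vector set \<Rightarrow> (real \<times> real) set \<Rightarrow> 'a set \<Rightarrow> 'a set" where
  "M_sum K M L = {a *\<^sub>R x + b *\<^sub>R y | a b x y. x \<in> K \<and> y \<in> L \<and> (a, b) \<in> M}"

definition given_by_support ::
    "('a::euclidean_space set \<Rightarrow> 'a set \<Rightarrow> 'a set) \<Rightarrow> (real \<times> real) set \<Rightarrow> bool" where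
  "given_by_support star M \<longleftrightarrow>
     (\<forall>K\<in>symmetric_bodies. \<forall>L\<in>symmetric_bodies. \<forall>x.
        support_function (star K L) x
          = support_function M (support_function K x, support_function L x))"

definition given_by_M_sum ::
    "('a::euclidean_space set \<Rightarrow> 'a set \<Rightarrow> 'a set) \<Rightarrow> (real \<times> real) set \<Rightarrow> bool" where
  "given_by_M_sum star M \<longleftrightarrow>
     (\<forall>K\<in>symmetric_bodies. \<forall>L\<in>symmetric_bodies. star K L = M_sum K M L)"

end

theory Submission
  imports Defs
begin

text \<open>Write \<open>f\<^sub>u s t\<close> for the value at a unit vector \<open>u\<close> of the support function of
  \<open>[-su, su] * [-tu, tu]\<close>. Projecting onto the line through \<open>u\<close> shows that
  \<open>h (K * L) u = f\<^sub>u (h K u) (h L u)\<close>. Projecting \<open>[-su, su] * [-tu, tu]\<close>, which lies on the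
  line through \<open>u\<close>, onto the line through \<open>v\<close> gives \<open>f\<^sub>v (cs) (ct) = c f\<^sub>u s t\<close> with
  \<open>c = u \<bullet> v \<ge> 0\<close>. Going from \<open>u\<close> to \<open>v\<close> and back makes \<open>f\<^sub>u\<close> positively homogeneous, and then
  \<open>f\<^sub>u\<close> does not depend on \<open>u\<close>. For orthonormal \<open>e\<^sub>1, e\<^sub>2\<close> the support function of
  \<open>[-e\<^sub>1, e\<^sub>1] * [-e\<^sub>2, e\<^sub>2]\<close> at \<open>s e\<^sub>1 + t e\<^sub>2\<close> is therefore \<open>f \<bar>s\<bar> \<bar>t\<bar>\<close>, so the projection of this
  body to the plane of \<open>e\<^sub>1, e\<^sub>2\<close> can serve as \<open>M\<close>.\<close>

section \<open>Support functions\<close>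

lemma convex_bodiesD:
  assumes "K \<in> convex_bodies"
  shows "K \<noteq> {}" "compact K" "convex K"
  using assms by (auto simp: convex_bodies_def)

lemma symmetric_bodies_imp_convex: "K \<in> symmetric_bodies \<Longrightarrow> K \<in> convex_bodies"
  by (simp add: symmetric_bodies_def)

lemma symmetric_bodies_uminus: "K \<in> symmetric_bodies \<Longrightarrow> y \<in> K \<Longrightarrow> - y \<in> K"
  by (auto simp: symmetric_bodies_def)

lemma support_function_eqI:
  assumes "z \<in> K" "x \<bullet> z = m" "\<And>y. y \<in> K \<Longrightarrow> x \<bullet> y \<le> m"
  shows "support_function K x = m"
  unfolding support_function_def using assms by (intro cSup_eq_maximum) auto

text \<open>Compactness turns the supremum into a maximum; later equalities of support functions are
  proved by exhibiting a maximiser.\<close>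

lemma support_function_attained:
  assumes "K \<in> convex_bodies"
  obtains y where "y \<in> K" "support_function K x = x \<bullet> y"
proof -
  have "\<exists>z\<in>K. \<forall>y\<in>K. x \<bullet> y \<le> x \<bullet> z"
    using convex_bodiesD[OF assms] by (intro continuous_attains_sup continuous_intros) auto
  then show thesis using that support_function_eqI by metis
qed

lemma inner_le_support_function:
  assumes "K \<in> convex_bodies" "y \<in> K"
  shows "x \<bullet> y \<le> support_function K x"
proof -
  have "bdd_above ((\<bullet>) x ` K)"
    using convex_bodiesD[OF assms(1)]
    by (intro compact_imp_bounded[THEN bounded_imp_bdd_above] compact_continuous_image
        continuous_intros)
  then show ?thesis unfolding support_function_def using assms(2) by (rule cSUP_upper[rotated])
qed

lemma support_function_scaleR:
  assumes "K \<in> convex_bodies" "c \<ge> 0"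
  shows "support_function K (c *\<^sub>R x) = c * support_function K x"
proof -
  obtain y where "y \<in> K" "support_function K x = x \<bullet> y"
    using support_function_attained[OF assms(1)] .
  then show ?thesis
    using inner_le_support_function[OF assms(1), of _ x] assms(2)
    by (intro support_function_eqI[of y]) (auto intro: mult_left_mono)
qed

lemma support_function_uminus:
  assumes "K \<in> symmetric_bodies"
  shows "support_function K (- x) = support_function K x"
proof -
  obtain y where "y \<in> K" "support_function K x = x \<bullet> y"
    using support_function_attained[OF symmetric_bodies_imp_convex[OF assms]] .
  moreover have "- x \<bullet> z \<le> support_function K x" if "z \<in> K" for z
    using inner_le_support_function[OF symmetric_bodies_imp_convex[OF assms]
        symmetric_bodies_uminus[OF assms that], of x] by simp
  ultimately show ?thesis
    using symmetric_bodies_uminus[OF assms] by (intro support_function_eqI[of "- y"]) auto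
qed

lemma support_function_scaleR_symmetric:
  assumes "K \<in> symmetric_bodies"
  shows "support_function K (c *\<^sub>R x) = \<bar>c\<bar> * support_function K x"
proof -
  have "support_function K (c *\<^sub>R x) = support_function K (\<bar>c\<bar> *\<^sub>R x)"
    using support_function_uminus[OF assms, of "c *\<^sub>R x"] by (cases "c \<ge> 0") auto
  then show ?thesis
    using support_function_scaleR[OF symmetric_bodies_imp_convex[OF assms]] by simp
qed

lemma support_function_nonneg:
  assumes "K \<in> symmetric_bodies"
  shows "support_function K x \<ge> 0"
proof -
  obtain y where "y \<in> K" using convex_bodiesD(1)[OF symmetric_bodies_imp_convex[OF assms]] by auto
  then have "x \<bullet> y \<le> support_function K x" "x \<bullet> - y \<le> support_function K x"
    using inner_le_support_function[OF symmetric_bodies_imp_convex[OF assms]]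
      symmetric_bodies_uminus[OF assms] by blast+
  then show ?thesis by simp
qed

text \<open>Here \<open>x'\<close> is the value at \<open>x\<close> of the adjoint of
  \<open>f\<close>. This serves projections, coordinate reflections and the coordinate map onto the
  plane alike.\<close>

lemma support_function_image:
  assumes "\<And>y. x \<bullet> f y = x' \<bullet> y"
  shows "support_function (f ` K) x = support_function K x'"
  by (simp add: support_function_def image_image assms)

text \<open>A point of \<open>K\<close> outside \<open>L\<close> could be strictly separated from
  \<open>L\<close>, and in the direction of the normal the support function of \<open>K\<close>
  would exceed that of \<open>L\<close>.\<close>

lemma support_function_le_imp_subset:
  assumes "K \<in> convex_bodies" "L \<in> convex_bodies"
    and "\<And>x. support_function K x \<le> support_function L x"
  shows "K \<subseteq> L"
proof
  fix z assume "z \<in> K"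
  show "z \<in> L"
  proof (rule ccontr)
    assume "z \<notin> L"
    then obtain a b where ab: "a \<bullet> z < b" "\<And>y. y \<in> L \<Longrightarrow> a \<bullet> y > b"
      using separating_hyperplane_closed_point[of L z] convex_bodiesD[OF assms(2)]
      by (metis compact_imp_closed)
    \<comment> \<open>The separating half-space puts \<open>L\<close> on the side of larger values
      of \<open>a\<close>, so the outer normal of \<open>L\<close> is \<open>- a\<close>.\<close>
    obtain y where "y \<in> L" "support_function L (- a) = - a \<bullet> y"
      using support_function_attained[OF assms(2)] .
    then show False
      using inner_le_support_function[OF assms(1) \<open>z \<in> K\<close>, of "- a"] assms(3)[of "- a"] ab
      by fastforce
  qed
qed

lemma support_function_eq_imp_eq:
  assumes "K \<in> convex_bodies" "L \<in> convex_bodies"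
    and "\<And>x. support_function K x = support_function L x"
  shows "K = L"
  using support_function_le_imp_subset[of K L] support_function_le_imp_subset[of L K] assms by force

lemma convex_bodies_linear_image:
  assumes "linear f" "K \<in> convex_bodies"
  shows "f ` K \<in> convex_bodies"
proof -
  have "continuous_on K f" using assms(1) by (simp add: linear_continuous_on linear_linear)
  then show ?thesis
    using convex_bodiesD[OF assms(2)] compact_continuous_image convex_linear_image[OF assms(1)]
    by (auto simp: convex_bodies_def)
qed

lemma symmetric_bodies_linear_image:
  assumes "linear f" "K \<in> symmetric_bodies"
  shows "f ` K \<in> symmetric_bodies"
proof -
  have "uminus ` f ` K = f ` uminus ` K"
    using assms(1) by (auto simp: image_image linear_neg)
  moreover have "uminus ` K = K" using assms(2) by (simp add: symmetric_bodies_def)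
  ultimately show ?thesis
    using assms convex_bodies_linear_image by (auto simp: symmetric_bodies_def)
qed

section \<open>Symmetric segments and orthogonal projections\<close>

text \<open>The segment from \<open>- y\<close> to \<open>y\<close>, written as a linear image of an
  interval so that it inherits being a symmetric body; it is a single point when
  \<open>y = 0\<close>.\<close>

definition symmetric_segment :: "'a::euclidean_space \<Rightarrow> 'a set" where
  "symmetric_segment y = (\<lambda>r. r *\<^sub>R y) ` {-1..1}"

lemma symmetric_segment_body: "symmetric_segment y \<in> symmetric_bodies"
proof -
  have "{-1..1::real} \<in> symmetric_bodies"
    by (auto simp: symmetric_bodies_def convex_bodies_def)
  then show ?thesis
    unfolding symmetric_segment_def
    by (intro symmetric_bodies_linear_image bounded_linear.linear bounded_linear_scaleR_left)
qed

lemma support_function_symmetric_segment: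
  "support_function (symmetric_segment y) x = \<bar>x \<bullet> y\<bar>"
proof (rule support_function_eqI)
  \<comment> \<open>The maximiser is the endpoint on the side of \<open>x\<close>, or the origin
    when \<open>x\<close> and \<open>y\<close> are orthogonal.\<close>
  show "sgn (x \<bullet> y) *\<^sub>R y \<in> symmetric_segment y"
    unfolding symmetric_segment_def by (intro imageI) (auto simp: sgn_if)
  show "x \<bullet> sgn (x \<bullet> y) *\<^sub>R y = \<bar>x \<bullet> y\<bar>" by (simp add: abs_sgn mult.commute)
  fix z assume "z \<in> symmetric_segment y"
  then obtain r where "r \<in> {-1..1}" and z: "z = r *\<^sub>R y"
    unfolding symmetric_segment_def by blast
  then have r: "\<bar>r\<bar> \<le> 1" by auto
  have "x \<bullet> z \<le> \<bar>r\<bar> * \<bar>x \<bullet> y\<bar>" by (metis z abs_ge_self abs_mult inner_scaleR_right)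
  also have "\<dots> \<le> \<bar>x \<bullet> y\<bar>" using r by (simp add: mult_left_le_one_le)
  finally show "x \<bullet> z \<le> \<bar>x \<bullet> y\<bar>" .
qed

lemma linear_orth_proj:
  assumes "subspace S"
  shows "linear (orth_proj S)"
proof (rule linearI)
  have orth: "(x - orth_proj S x) \<bullet> z = 0" if "z \<in> S" for x z
    using orth_proj(2)[OF assms that] by (simp add: orthogonal_def)
  fix x y r
  show "orth_proj S (x + y) = orth_proj S x + orth_proj S y"
  proof (rule orth_proj_unique[OF assms])
    show "orth_proj S x + orth_proj S y \<in> S"
      using assms orth_proj(1)[OF assms] by (simp add: subspace_add)
    show "orthogonal (x + y - (orth_proj S x + orth_proj S y)) z" if "z \<in> S" for z
      using orth[OF that, of x] orth[OF that, of y]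
      by (simp add: orthogonal_def inner_diff_left inner_add_left)
  qed
  show "orth_proj S (r *\<^sub>R x) = r *\<^sub>R orth_proj S x"
  proof (rule orth_proj_unique[OF assms])
    show "r *\<^sub>R orth_proj S x \<in> S"
      using assms orth_proj(1)[OF assms] by (simp add: subspace_scale)
    show "orthogonal (r *\<^sub>R x - r *\<^sub>R orth_proj S x) z" if "z \<in> S" for z
      using orth[OF that, of x]
      by (simp add: orthogonal_def inner_diff_left)
  qed
qed

text \<open>Both sides equal the inner product of the two projections, because the residuals are
  orthogonal to \<open>S\<close>.\<close>

lemma orth_proj_self_adjoint:
  assumes "subspace S"
  shows "x \<bullet> orth_proj S y = orth_proj S x \<bullet> y"
proof -
  have "(x - orth_proj S x) \<bullet> orth_proj S y = 0" "(y - orth_proj S y) \<bullet> orth_proj S x = 0"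
    using orth_proj[OF assms] by (auto simp: orthogonal_def)
  then have "x \<bullet> orth_proj S y = orth_proj S x \<bullet> orth_proj S y"
    "y \<bullet> orth_proj S x = orth_proj S y \<bullet> orth_proj S x"
    by (auto simp: inner_diff_left)
  then show ?thesis by (metis inner_commute)
qed

lemma support_function_orth_proj:
  assumes "subspace S"
  shows "support_function (orth_proj S ` K) x = support_function K (orth_proj S x)"
  by (rule support_function_image) (rule orth_proj_self_adjoint[OF assms])

lemma orth_proj_line:
  assumes "norm u = 1"
  shows "orth_proj (span {u}) x = (x \<bullet> u) *\<^sub>R u"
proof (rule orth_proj_unique)
  show "orthogonal (x - (x \<bullet> u) *\<^sub>R u) z" if "z \<in> span {u}" for z
    using that assms
    by (auto simp: span_singleton orthogonal_def inner_diff_left dot_square_norm)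
qed (auto intro: span_mul span_base)

text \<open>Both sets have support function
  \<open>\<bar>x \<bullet> u\<bar> * support_function K u\<close>. Hence, after projection to a
  line, a symmetric body matters only through one number.\<close>

lemma orth_proj_line_image:
  assumes "norm u = 1" "K \<in> symmetric_bodies"
  shows "orth_proj (span {u}) ` K = symmetric_segment (support_function K u *\<^sub>R u)"
proof (rule support_function_eq_imp_eq)
  show "orth_proj (span {u}) ` K \<in> convex_bodies"
    using assms by (intro convex_bodies_linear_image linear_orth_proj symmetric_bodies_imp_convex)
      (auto intro: subspace_span)
  show "symmetric_segment (support_function K u *\<^sub>R u) \<in> convex_bodies"
    by (intro symmetric_bodies_imp_convex symmetric_segment_body)
  show "support_function (orth_proj (span {u}) ` K) x =
      support_function (symmetric_segment (support_function K u *\<^sub>R u)) x" for x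
    using support_function_nonneg[OF assms(2), of u]
    unfolding support_function_orth_proj[OF subspace_span] orth_proj_line[OF assms(1)]
    by (simp add: abs_mult support_function_scaleR_symmetric[OF assms(2)]
        support_function_symmetric_segment)
qed

section \<open>Projection covariant operations\<close>

lemma dim_span_unit:
  assumes "norm (u::'a::euclidean_space) = 1"
  shows "dim (span {u}) = 1"
  using assms by (subst dim_span, subst dim_singleton) auto

locale covariant_operation =
  fixes star :: "'a::euclidean_space set \<Rightarrow> 'a set \<Rightarrow> 'a set"
  assumes dim: "DIM('a) \<ge> 2"
    and body: "\<And>K L. K \<in> symmetric_bodies \<Longrightarrow> L \<in> symmetric_bodies \<Longrightarrow> star K L \<in> convex_bodies"
    and covariant: "projection_covariant star"
begin

text \<open>This is \<open>f\<^sub>u\<close> of the opening comment. It is even in \<open>s\<close>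
  and in \<open>t\<close>, so nonnegative arguments carry all the information.\<close>

definition line_function :: "'a \<Rightarrow> real \<Rightarrow> real \<Rightarrow> real" where
  "line_function u s t =
     support_function (star (symmetric_segment (s *\<^sub>R u)) (symmetric_segment (t *\<^sub>R u))) u"

lemma proj_line_star:
  assumes "norm u = 1" "K \<in> symmetric_bodies" "L \<in> symmetric_bodies"
  shows "orth_proj (span {u}) ` star K L =
     star (symmetric_segment (support_function K u *\<^sub>R u))
          (symmetric_segment (support_function L u *\<^sub>R u))"
proof -
  \<comment> \<open>Lines are among the subspaces allowed in covariance because the dimension of the
    space is at least 2.\<close>
  have "subspace (span {u}) \<and> 1 \<le> dim (span {u}) \<and> dim (span {u}) \<le> DIM('a) - 1"
    using dim_span_unit[OF assms(1)] dim by (simp add: subspace_span)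
  then have "orth_proj (span {u}) ` star K L =
      star (orth_proj (span {u}) ` K) (orth_proj (span {u}) ` L)"
    using covariant assms(2,3) unfolding projection_covariant_def by blast
  then show ?thesis using assms by (simp only: orth_proj_line_image)
qed

text \<open>The projection onto \<open>span {u}\<close> fixes \<open>u\<close>, so it preserves the
  value of a support function at \<open>u\<close>; covariance then replaces both arguments by
  segments.\<close>

lemma support_function_star_unit:
  assumes "norm u = 1" "K \<in> symmetric_bodies" "L \<in> symmetric_bodies"
  shows "support_function (star K L) u =
     line_function u (support_function K u) (support_function L u)"
proof -
  have "support_function (star K L) u = support_function (orth_proj (span {u}) ` star K L) u"
    unfolding support_function_orth_proj[OF subspace_span] orth_proj_line[OF assms(1)]
    using assms(1) by (simp add: dot_square_norm)
  then show ?thesis by (simp add: proj_line_star[OF assms] line_function_def)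
qed

section \<open>Homogeneity and independence of the direction\<close>

lemma line_function_transfer:
  assumes u: "norm u = 1" and v: "norm v = 1" and c: "v \<bullet> u \<ge> 0" and st: "s \<ge> 0" "t \<ge> 0"
  shows "line_function v ((v \<bullet> u) * s) ((v \<bullet> u) * t) = (v \<bullet> u) * line_function u s t"
proof -
  define K where "K = symmetric_segment (s *\<^sub>R u)"
  define L where "L = symmetric_segment (t *\<^sub>R u)"
  have KL: "K \<in> symmetric_bodies" "L \<in> symmetric_bodies"
    by (auto simp: K_def L_def symmetric_segment_body)
  have h: "support_function K x = \<bar>x \<bullet> u\<bar> * s" "support_function L x = \<bar>x \<bullet> u\<bar> * t" for x
    using st by (auto simp: K_def L_def support_function_symmetric_segment abs_mult)
  \<comment> \<open>The projection onto \<open>span {u}\<close> fixes both segments, so by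
    covariance it fixes \<open>star K L\<close>, which therefore lies on that line. Its support
    function at \<open>v\<close> is now computable from the one at \<open>u\<close>.\<close>
  have "orth_proj (span {u}) ` star K L = star K L"
    using proj_line_star[OF u KL] u by (simp add: h dot_square_norm) (simp add: K_def L_def)
  then have "support_function (star K L) v = support_function (star K L) ((v \<bullet> u) *\<^sub>R u)"
    using support_function_orth_proj[of "span {u}" "star K L" v] orth_proj_line[OF u] by simp
  also have "\<dots> = (v \<bullet> u) * line_function u s t"
    using support_function_scaleR[OF body[OF KL] c] by (simp add: line_function_def K_def L_def)
  finally show ?thesis
    using support_function_star_unit[OF v KL] c by (simp add: h)
qed

lemma line_function_homogeneous:
  assumes "norm u = 1" "r > 0" "s \<ge> 0" "t \<ge> 0"
  shows "line_function u (r * s) (r * t) = r * line_function u s t"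
proof -
  have le1: "line_function u (r * s) (r * t) = r * line_function u s t"
    if r: "0 < r" "r \<le> 1" and st: "s \<ge> 0" "t \<ge> 0" for r s t
  proof -
    obtain y where y: "y \<noteq> 0" "orthogonal u y" using orthogonal_to_vector_exists[OF dim] by blast
    define w where "w = y /\<^sub>R norm y"
    have w: "w \<bullet> w = 1" "u \<bullet> w = 0" "w \<bullet> u = 0"
      using y by (auto simp: w_def orthogonal_def inner_commute dot_square_norm power2_eq_square)
    \<comment> \<open>The passage from \<open>u\<close> to \<open>v\<close> and the passage back
      each contribute the factor \<open>v \<bullet> u\<close>. Choosing it as the square root of
      \<open>r\<close> gives \<open>r\<close> in total; a unit vector \<open>v\<close> with this
      inner product exists since \<open>r \<le> 1\<close>.\<close>
    define c where "c = sqrt r"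
    have c: "c \<ge> 0" "c * c = r" using r by (auto simp: c_def)
    define v where "v = c *\<^sub>R u + sqrt (1 - r) *\<^sub>R w"
    have uu: "u \<bullet> u = 1" using assms(1) by (simp add: dot_square_norm)
    have "v \<bullet> v = 1"
      using w uu c r by (simp add: v_def inner_add_left inner_add_right)
    then have v: "norm v = 1" by (simp add: norm_eq_sqrt_inner)
    have vu: "v \<bullet> u = c" "u \<bullet> v = c" using w uu by (auto simp: v_def inner_add_left inner_add_right)
    show ?thesis
      using line_function_transfer[OF assms(1) v, of s t]
        line_function_transfer[OF v assms(1), of "c * s" "c * t"] vu c st
      by (simp add: mult.assoc[symmetric])
  qed
  show ?thesis
  proof (cases "r \<le> 1")
    case True
    then show ?thesis using le1 assms by simp
  next
    case False
    \<comment> \<open>For \<open>r > 1\<close> the case already settled is applied to the factor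
      \<open>inverse r\<close> at the scaled arguments.\<close>
    then have "line_function u (inverse r * (r * s)) (inverse r * (r * t)) =
        inverse r * line_function u (r * s) (r * t)"
      using assms by (intro le1) (auto simp: inverse_le_1_iff)
    then show ?thesis using assms(2) by (simp add: field_simps)
  qed
qed

text \<open>Transfer and homogeneity of the function at \<open>v\<close> produce the same factor
  \<open>v \<bullet> u\<close>, which is positive and cancels.\<close>

lemma line_function_eq_if_pos:
  assumes u: "norm u = 1" and v: "norm v = 1" and c: "v \<bullet> u > 0" and st: "s \<ge> 0" "t \<ge> 0"
  shows "line_function u s t = line_function v s t"
  using line_function_transfer[OF u v _ st] line_function_homogeneous[OF v c st] c by simp

lemma line_function_eq:
  assumes u: "norm u = 1" and v: "norm v = 1" and st: "s \<ge> 0" "t \<ge> 0"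
  shows "line_function u s t = line_function v s t"
proof -
  have step: "line_function u s t = line_function v s t"
    if u: "norm u = 1" and v: "norm v = 1" and "u + v \<noteq> 0" for u v
  proof -
    \<comment> \<open>The normalised bisector has positive inner product with both \<open>u\<close>
      and \<open>v\<close>, since \<open>(u + v) \<bullet> u = 1 + u \<bullet> v\<close> is positive
      unless the two are antipodal.\<close>
    define w where "w = (u + v) /\<^sub>R norm (u + v)"
    have w: "norm w = 1" using that by (simp add: w_def)
    have uv: "u \<bullet> u = 1" "v \<bullet> v = 1" using u v by (auto simp: dot_square_norm)
    have "(u + v) \<bullet> (u + v) > 0" using that by simp
    then have "u \<bullet> v > - 1" using uv by (simp add: inner_add_left inner_add_right inner_commute)
    then have "w \<bullet> u > 0" "v \<bullet> w > 0"
      using that uv by (auto simp: w_def inner_add_left inner_add_right inner_commute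
          intro!: mult_pos_pos)
    then show ?thesis
      using line_function_eq_if_pos[OF u w _ st] line_function_eq_if_pos[OF w v _ st] by simp
  qed
  show ?thesis
  proof (cases "u + v = 0")
    case True
    \<comment> \<open>Antipodal vectors are connected through a unit vector orthogonal to
      \<open>u\<close>, which is antipodal to neither of them.\<close>
    obtain y where y: "y \<noteq> 0" "orthogonal u y" using orthogonal_to_vector_exists[OF dim] by blast
    define w where "w = y /\<^sub>R norm y"
    have w: "norm w = 1" using y by (simp add: w_def)
    have "u \<bullet> w = 0" using y by (auto simp: w_def orthogonal_def)
    moreover have "u \<bullet> u = 1" using u by (simp add: dot_square_norm)
    ultimately have "u \<bullet> (u + w) \<noteq> 0" "u \<bullet> (w - u) \<noteq> 0"
      by (auto simp: inner_add_right inner_diff_right)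
    moreover have "v = - u" using True by (simp add: eq_neg_iff_add_eq_0 add.commute)
    ultimately have "u + w \<noteq> 0" "w + v \<noteq> 0" by auto
    then show ?thesis using step u v w by metis
  qed (use step u v in blast)
qed

lemma exists_representing_body:
  "\<exists>M\<in>convex_bodies. unconditional M \<and> given_by_support star M"
proof -
  obtain e1 :: 'a where e1: "norm e1 = 1" using vector_choose_size[of 1] by auto
  obtain y where y: "y \<noteq> 0" "orthogonal e1 y" using orthogonal_to_vector_exists[OF dim] by blast
  define e2 where "e2 = y /\<^sub>R norm y"
  have e: "e1 \<bullet> e1 = 1" "e2 \<bullet> e2 = 1" "e1 \<bullet> e2 = 0" "e2 \<bullet> e1 = 0"
    using y e1 by (auto simp: e2_def orthogonal_def inner_commute dot_square_norm power2_eq_square)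
  define f where "f = line_function e1"
  have star: "support_function (star K L) x = f (support_function K x) (support_function L x)"
    if K: "K \<in> symmetric_bodies" and L: "L \<in> symmetric_bodies" and x: "x \<noteq> 0" for K L x
  proof -
    \<comment> \<open>The formula for unit vectors extends to \<open>x \<noteq> 0\<close> because
      both sides are positively homogeneous.\<close>
    define u where "u = x /\<^sub>R norm x"
    have u: "norm u = 1" "x = norm x *\<^sub>R u" using x by (auto simp: u_def)
    have nonneg: "support_function K u \<ge> 0" "support_function L u \<ge> 0"
      using K L support_function_nonneg by auto
    have scale: "support_function A x = norm x * support_function A u" if "A \<in> convex_bodies" for A
      using support_function_scaleR[OF that, of "norm x" u] u(2) by simp
    have "support_function (star K L) x = norm x * f (support_function K u) (support_function L u)"
      using scale[OF body[OF K L]] support_function_star_unit[OF u(1) K L]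
        line_function_eq[OF u(1) e1 nonneg] by (simp add: f_def)
    also have "\<dots> = f (norm x * support_function K u) (norm x * support_function L u)"
      using line_function_homogeneous[OF e1 _ nonneg, of "norm x"] x by (simp add: f_def)
    finally show ?thesis using scale K L symmetric_bodies_imp_convex by metis
  qed
  \<comment> \<open>Homogeneity with the factor 2 forces the value at the origin to vanish, which
    settles \<open>x = 0\<close>.\<close>
  have zero: "f 0 0 = 0"
    using line_function_homogeneous[OF e1, of 2 0 0] by (simp add: f_def)
  have at0: "support_function A 0 = 0" if "A \<in> convex_bodies" for A :: "'a set"
    using support_function_scaleR[OF that, of 0 0] by simp
  have star': "support_function (star K L) x = f (support_function K x) (support_function L x)"
    if K: "K \<in> symmetric_bodies" and L: "L \<in> symmetric_bodies" for K L x
    using star[OF K L] zero at0[OF body[OF K L]] at0[OF symmetric_bodies_imp_convex[OF K]]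
      at0[OF symmetric_bodies_imp_convex[OF L]] by (cases "x = 0") auto
  define K where "K = symmetric_segment e1"
  define L where "L = symmetric_segment e2"
  have KL: "K \<in> symmetric_bodies" "L \<in> symmetric_bodies"
    by (auto simp: K_def L_def symmetric_segment_body)
  \<comment> \<open>\<open>p\<close> takes coordinates with respect to \<open>e1\<close> and
    \<open>e2\<close>, and its adjoint sends \<open>(s, t)\<close> to
    \<open>s *\<^sub>R e1 + t *\<^sub>R e2\<close>. At that vector the two segments have support
    values \<open>\<bar>s\<bar>\<close> and \<open>\<bar>t\<bar>\<close>.\<close>
  define p where "p = (\<lambda>z. (z \<bullet> e1, z \<bullet> e2))"
  have p: "linear p" by (rule linearI) (auto simp: p_def inner_add_left)
  define M where "M = p ` star K L"
  have M: "M \<in> convex_bodies"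
    unfolding M_def using convex_bodies_linear_image[OF p body[OF KL]] .
  have hM: "support_function M (s, t) = f \<bar>s\<bar> \<bar>t\<bar>" for s t
  proof -
    have "support_function M (s, t) = support_function (star K L) (s *\<^sub>R e1 + t *\<^sub>R e2)"
      unfolding M_def
      by (rule support_function_image) (simp add: p_def inner_add_left inner_commute[of _ e1] inner_commute[of _ e2])
    then show ?thesis
      using e by (simp add: star'[OF KL])
        (simp add: K_def L_def support_function_symmetric_segment inner_add_left)
  qed
  have "unconditional M"
    unfolding unconditional_def
  proof
    have l: "linear (\<lambda>(a, b). (a, - b) :: real \<times> real)" "linear (\<lambda>(a, b). (- a, b) :: real \<times> real)"
      by (auto intro!: linearI)
    \<comment> \<open>The support function of \<open>M\<close> ignores the signs of its arguments
      and determines \<open>M\<close>. A reflection only changes such a sign, so each reflected copy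
      of \<open>M\<close> is \<open>M\<close> itself.\<close>
    have eq: "N = M" if "N \<in> convex_bodies" "\<And>s t. support_function N (s, t) = f \<bar>s\<bar> \<bar>t\<bar>" for N
      using that hM by (intro support_function_eq_imp_eq[OF that(1) M]) (auto split: prod.split)
    have "support_function ((\<lambda>(a, b). (a, - b)) ` M) (s, t) = support_function M (s, - t)"
      and "support_function ((\<lambda>(a, b). (- a, b)) ` M) (s, t) = support_function M (- s, t)" for s t
      by (auto intro!: support_function_image)
    then show "(\<lambda>(a, b). (a, - b)) ` M = M" "(\<lambda>(a, b). (- a, b)) ` M = M"
      by (intro eq l[THEN convex_bodies_linear_image, OF M]; simp add: hM)+
  qed
  moreover have "given_by_support star M"
    unfolding given_by_support_def by (auto simp: star' hM support_function_nonneg)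
  ultimately show ?thesis using M by blast
qed

end

section \<open>Bodies in the plane and M-addition\<close>

lemma unconditionalD:
  assumes "unconditional M" "(a, b) \<in> M"
  shows "(a, - b) \<in> M" "(- a, b) \<in> M"
  using assms by (force simp: unconditional_def)+

lemma unconditional_abs:
  assumes "unconditional M" "(a, b) \<in> M"
  shows "(\<bar>a\<bar>, \<bar>b\<bar>) \<in> M"
  using assms unconditionalD[OF assms(1)] by (auto simp: abs_if)

text \<open>The coordinate reflections are self-adjoint and fix \<open>M\<close>. Hence the
  nonnegative quadrant determines the support function, which uniqueness relies on.\<close>

lemma support_function_abs:
  assumes "M \<in> convex_bodies" "unconditional M"
  shows "support_function M (s, t) = support_function M (\<bar>s\<bar>, \<bar>t\<bar>)"
proof -
  have "support_function M (- s, t) = support_function ((\<lambda>(a, b). (- a, b)) ` M) (s, t)"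
    and "support_function M (s, - t) = support_function ((\<lambda>(a, b). (a, - b)) ` M) (s, t)" for s t
    by (auto intro!: support_function_image[symmetric])
  then have "support_function M (- s, t) = support_function M (s, t)"
    and "support_function M (s, - t) = support_function M (s, t)" for s t
    using assms(2) by (simp_all add: unconditional_def)
  then show ?thesis by (simp add: abs_if)
qed

text \<open>For fixed \<open>(a, b)\<close>, symmetry of \<open>K\<close> and \<open>L\<close> makes
  the supremum over their points equal to \<open>\<bar>a\<bar> * support_function K x +
  \<bar>b\<bar> * support_function L x\<close>. Since \<open>M\<close> also contains
  \<open>(\<bar>a\<bar>, \<bar>b\<bar>)\<close>, maximising over \<open>M\<close> gives its support
  function.\<close>

lemma support_function_M_sum:
  assumes M: "M \<in> convex_bodies" "unconditional M"
    and K: "K \<in> symmetric_bodies" and L: "L \<in> symmetric_bodies"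
  shows "support_function (M_sum K M L) x =
     support_function M (support_function K x, support_function L x)"
proof -
  note K' = symmetric_bodies_imp_convex[OF K] and L' = symmetric_bodies_imp_convex[OF L]
  obtain a b where ab: "(a, b) \<in> M"
    "support_function M (support_function K x, support_function L x) =
      (support_function K x, support_function L x) \<bullet> (a, b)"
    using support_function_attained[OF M(1)] by (metis surj_pair)
  obtain y where y: "y \<in> K" "support_function K x = x \<bullet> y" using support_function_attained[OF K'] .
  obtain z where z: "z \<in> L" "support_function L x = x \<bullet> z" using support_function_attained[OF L'] .
  show ?thesis
  proof (rule support_function_eqI)
    show "a *\<^sub>R y + b *\<^sub>R z \<in> M_sum K M L" using ab y z by (auto simp: M_sum_def)
    show "x \<bullet> (a *\<^sub>R y + b *\<^sub>R z) = support_function M (support_function K x, support_function L x)"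
      using ab y z by (simp add: inner_add_right mult.commute)
    fix w assume "w \<in> M_sum K M L"
    then obtain a' b' y' z' where w: "w = a' *\<^sub>R y' + b' *\<^sub>R z'" "y' \<in> K" "z' \<in> L" "(a', b') \<in> M"
      by (auto simp: M_sum_def)
    have "\<bar>x \<bullet> y'\<bar> \<le> support_function K x" "\<bar>x \<bullet> z'\<bar> \<le> support_function L x"
      using inner_le_support_function[OF K' w(2), of x] inner_le_support_function[OF L' w(3), of x]
        inner_le_support_function[OF K' symmetric_bodies_uminus[OF K w(2)], of x]
        inner_le_support_function[OF L' symmetric_bodies_uminus[OF L w(3)], of x] by auto
    then have "\<bar>a'\<bar> * \<bar>x \<bullet> y'\<bar> \<le> \<bar>a'\<bar> * support_function K x"
      "\<bar>b'\<bar> * \<bar>x \<bullet> z'\<bar> \<le> \<bar>b'\<bar> * support_function L x" by (auto intro: mult_left_mono)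
    moreover have "x \<bullet> w \<le> \<bar>a'\<bar> * \<bar>x \<bullet> y'\<bar> + \<bar>b'\<bar> * \<bar>x \<bullet> z'\<bar>"
      unfolding w(1) inner_add_right inner_scaleR_right
      by (metis abs_ge_self abs_mult add_mono)
    ultimately have "x \<bullet> w \<le> (support_function K x, support_function L x) \<bullet> (\<bar>a'\<bar>, \<bar>b'\<bar>)"
      by (simp add: mult.commute)
    also have "\<dots> \<le> support_function M (support_function K x, support_function L x)"
      using inner_le_support_function[OF M(1) unconditional_abs[OF M(2) w(4)]] .
    finally show "x \<bullet> w \<le> support_function M (support_function K x, support_function L x)" .
  qed
qed

text \<open>Dividing by \<open>a + b\<close> gives a convex combination; if the sum is zero, both
  coefficients vanish and any point of \<open>K\<close> serves.\<close>

lemma convex_scaled_combination: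
  assumes "convex K" "x \<in> K" "y \<in> K" "a \<ge> 0" "b \<ge> (0::real)"
  obtains z where "z \<in> K" "a *\<^sub>R x + b *\<^sub>R y = (a + b) *\<^sub>R z"
proof (cases "a + b = 0")
  case True
  then have "a = 0" "b = 0" using assms by auto
  then show thesis using that assms by simp
next
  case False
  have "(a / (a + b)) *\<^sub>R x + (b / (a + b)) *\<^sub>R y \<in> K"
    using assms False by (intro convexD) (auto simp: add_divide_distrib[symmetric])
  then show thesis using that False by (simp add: scaleR_add_right)
qed

text \<open>Signs move from the coefficients to the points by symmetry of \<open>K\<close> and
  \<open>L\<close>. Nonnegative coefficients are what merging two points of a convex set
  requires.\<close>

lemma M_sum_nonneg_coefficients:
  assumes "unconditional M" "K \<in> symmetric_bodies" "L \<in> symmetric_bodies" "w \<in> M_sum K M L"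
  obtains a b x y where "w = a *\<^sub>R x + b *\<^sub>R y" "x \<in> K" "y \<in> L" "(a, b) \<in> M" "a \<ge> 0" "b \<ge> 0"
proof -
  obtain a b x y where w: "w = a *\<^sub>R x + b *\<^sub>R y" "x \<in> K" "y \<in> L" "(a, b) \<in> M"
    using assms(4) by (auto simp: M_sum_def)
  show thesis
  proof (rule that)
    show "w = \<bar>a\<bar> *\<^sub>R (if a < 0 then - x else x) + \<bar>b\<bar> *\<^sub>R (if b < 0 then - y else y)"
      using w(1) by simp
    show "(if a < 0 then - x else x) \<in> K" "(if b < 0 then - y else y) \<in> L"
      using w(2,3) symmetric_bodies_uminus[OF assms(2)] symmetric_bodies_uminus[OF assms(3)] by simp_all
    show "(\<bar>a\<bar>, \<bar>b\<bar>) \<in> M" using unconditional_abs[OF assms(1) w(4)] .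
  qed simp_all
qed

lemma M_sum_convex_body:
  fixes K L :: "'a::euclidean_space set"
  assumes M: "M \<in> convex_bodies" "unconditional M"
    and K: "K \<in> symmetric_bodies" and L: "L \<in> symmetric_bodies"
  shows "M_sum K M L \<in> convex_bodies"
proof -
  note K' = convex_bodiesD[OF symmetric_bodies_imp_convex[OF K]]
  note L' = convex_bodiesD[OF symmetric_bodies_imp_convex[OF L]]
  note M' = convex_bodiesD[OF M(1)]
  \<comment> \<open>Compactness comes from this description as a continuous image of a compact
    product.\<close>
  have image: "M_sum K M L = (\<lambda>(m, x, y). fst m *\<^sub>R x + snd m *\<^sub>R y) ` (M \<times> K \<times> L)"
    unfolding M_sum_def image_def by (simp add: Bex_def) blast
  have "compact (M_sum K M L)"
    unfolding image using K' L' M'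
    by (intro compact_continuous_image compact_Times)
      (auto simp: case_prod_unfold intro!: continuous_intros)
  moreover have "M_sum K M L \<noteq> {}"
    using K' L' M' by (simp add: image)
  moreover have "convex (M_sum K M L)"
  proof (rule convexI)
    fix v w and p q :: real
    assume "v \<in> M_sum K M L" "w \<in> M_sum K M L" and pq: "0 \<le> p" "0 \<le> q" "p + q = 1"
    obtain a b x y where v: "v = a *\<^sub>R x + b *\<^sub>R y" "x \<in> K" "y \<in> L" "(a, b) \<in> M" "a \<ge> 0" "b \<ge> 0"
      using M_sum_nonneg_coefficients[OF M(2) K L \<open>v \<in> M_sum K M L\<close>] .
    obtain a' b' x' y' where w: "w = a' *\<^sub>R x' + b' *\<^sub>R y'" "x' \<in> K" "y' \<in> L" "(a', b') \<in> M"
        "a' \<ge> 0" "b' \<ge> 0"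
      using M_sum_nonneg_coefficients[OF M(2) K L \<open>w \<in> M_sum K M L\<close>] .
    \<comment> \<open>The two points of \<open>K\<close> merge into one, likewise those of
      \<open>L\<close>; the merged coefficients are the same convex combination of the two points of
      \<open>M\<close>.\<close>
    obtain x'' where x'': "x'' \<in> K" "(p * a) *\<^sub>R x + (q * a') *\<^sub>R x' = (p * a + q * a') *\<^sub>R x''"
      using convex_scaled_combination[OF K'(3) v(2) w(2), of "p * a" "q * a'"] pq v w by auto
    obtain y'' where y'': "y'' \<in> L" "(p * b) *\<^sub>R y + (q * b') *\<^sub>R y' = (p * b + q * b') *\<^sub>R y''"
      using convex_scaled_combination[OF L'(3) v(3) w(3), of "p * b" "q * b'"] pq v w by auto
    have "p *\<^sub>R v + q *\<^sub>R w = ((p * a) *\<^sub>R x + (q * a') *\<^sub>R x') + ((p * b) *\<^sub>R y + (q * b') *\<^sub>R y')"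
      by (simp add: v(1) w(1) scaleR_add_right)
    also have "\<dots> = (p * a + q * a') *\<^sub>R x'' + (p * b + q * b') *\<^sub>R y''"
      by (simp add: x'' y'')
    finally have "p *\<^sub>R v + q *\<^sub>R w = (p * a + q * a') *\<^sub>R x'' + (p * b + q * b') *\<^sub>R y''" .
    moreover have "(p * a + q * a', p * b + q * b') \<in> M"
      using convexD[OF M'(3) v(4) w(4) pq] by simp
    ultimately show "p *\<^sub>R v + q *\<^sub>R w \<in> M_sum K M L"
      using x'' y'' unfolding M_sum_def by blast
  qed
  ultimately show ?thesis by (simp add: convex_bodies_def)
qed

section \<open>Equivalence of the two forms, covariance and uniqueness\<close>

lemma given_by_support_iff_M_sum:
  assumes M: "M \<in> convex_bodies" "unconditional M"
    and body: "\<And>K L. K \<in> symmetric_bodies \<Longrightarrow> L \<in> symmetric_bodies \<Longrightarrow> star K L \<in> convex_bodies"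
  shows "given_by_support star M \<longleftrightarrow> given_by_M_sum star M"
proof
  \<comment> \<open>Both \<open>star K L\<close> and the M-sum are convex bodies, so equality of
    their support functions makes them equal.\<close>
  assume "given_by_support star M"
  then show "given_by_M_sum star M"
    unfolding given_by_M_sum_def given_by_support_def
    by (intro ballI support_function_eq_imp_eq M_sum_convex_body[OF M] body)
      (auto simp: support_function_M_sum[OF M])
next
  assume "given_by_M_sum star M"
  then show "given_by_support star M"
    unfolding given_by_M_sum_def given_by_support_def
    by (simp add: support_function_M_sum[OF M])
qed

text \<open>Self-adjointness of the projection turns the support function of either side at
  \<open>x\<close> into \<open>support_function M\<close> at the support values of \<open>K\<close>
  and \<open>L\<close> at \<open>orth_proj S x\<close>.\<close>

lemma given_by_support_imp_covariant:
  fixes star :: "'a::euclidean_space set \<Rightarrow> 'a set \<Rightarrow> 'a set"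
  assumes body: "\<And>K L. K \<in> symmetric_bodies \<Longrightarrow> L \<in> symmetric_bodies \<Longrightarrow> star K L \<in> convex_bodies"
    and M: "given_by_support star M"
  shows "projection_covariant star"
  unfolding projection_covariant_def
proof (intro ballI allI impI, elim conjE)
  fix K L S :: "'a set"
  assume K: "K \<in> symmetric_bodies" and L: "L \<in> symmetric_bodies" and S: "subspace S"
  note KS = symmetric_bodies_linear_image[OF linear_orth_proj[OF S] K]
    and LS = symmetric_bodies_linear_image[OF linear_orth_proj[OF S] L]
  show "orth_proj S ` star K L = star (orth_proj S ` K) (orth_proj S ` L)"
  proof (rule support_function_eq_imp_eq)
    show "orth_proj S ` star K L \<in> convex_bodies"
      using convex_bodies_linear_image[OF linear_orth_proj[OF S] body[OF K L]] .
    show "star (orth_proj S ` K) (orth_proj S ` L) \<in> convex_bodies" using body[OF KS LS] .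
    show "support_function (orth_proj S ` star K L) x =
        support_function (star (orth_proj S ` K) (orth_proj S ` L)) x" for x
      using M K L KS LS by (simp add: given_by_support_def support_function_orth_proj[OF S])
  qed
qed

text \<open>Segments along one unit vector realise every pair of nonnegative support values, so the
  operation fixes the support function of \<open>M\<close> on the nonnegative quadrant;
  unconditionality gives the rest.\<close>

lemma given_by_support_unique:
  fixes star :: "'a::euclidean_space set \<Rightarrow> 'a set \<Rightarrow> 'a set"
  assumes M: "M \<in> convex_bodies" "unconditional M" "given_by_support star M"
    and N: "N \<in> convex_bodies" "unconditional N" "given_by_support star N"
  shows "M = N"
proof (rule support_function_eq_imp_eq[OF M(1) N(1)])
  fix z :: "real \<times> real"
  obtain s t where z: "z = (s, t)" by fastforce
  obtain u :: 'a where "norm u = 1" using vector_choose_size[of 1] by auto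
  then have "u \<bullet> u = 1" by (simp add: dot_square_norm)
  then have "support_function (symmetric_segment (r *\<^sub>R u)) u = \<bar>r\<bar>" for r
    by (simp add: support_function_symmetric_segment)
  then have "support_function M (\<bar>s\<bar>, \<bar>t\<bar>) = support_function N (\<bar>s\<bar>, \<bar>t\<bar>)"
    using M(3) N(3) symmetric_segment_body unfolding given_by_support_def by metis
  then show "support_function M z = support_function N z"
    using support_function_abs[OF M(1,2)] support_function_abs[OF N(1,2)] z by metis
qed

theorem theorem7p6:
  fixes star :: "(real ^ 'n) set \<Rightarrow> (real ^ 'n) set \<Rightarrow> (real ^ 'n) set"
  assumes "CARD('n) \<ge> 2"
    and "\<forall>K\<in>symmetric_bodies. \<forall>L\<in>symmetric_bodies. star K L \<in> convex_bodies"
  shows "(projection_covariant star \<longleftrightarrow>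
            (\<exists>M\<in>convex_bodies. unconditional M \<and> given_by_support star M))
       \<and> (projection_covariant star \<longleftrightarrow>
            (\<exists>M\<in>convex_bodies. unconditional M \<and> given_by_M_sum star M))
       \<and> (\<forall>M\<in>convex_bodies. unconditional M \<longrightarrow>
            (given_by_support star M \<longleftrightarrow> given_by_M_sum star M))
       \<and> (projection_covariant star \<longrightarrow>
            (\<exists>!M. M \<in> convex_bodies \<and> unconditional M \<and> given_by_support star M)
            \<and> (\<exists>!M. M \<in> convex_bodies \<and> unconditional M \<and> given_by_M_sum star M))"
proof -
  have body: "\<And>K L. K \<in> symmetric_bodies \<Longrightarrow> L \<in> symmetric_bodies \<Longrightarrow> star K L \<in> convex_bodies"
    using assms(2) by blast
  have ex: "\<exists>M\<in>convex_bodies. unconditional M \<and> given_by_support star M"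
    if "projection_covariant star"
    using covariant_operation.exists_representing_body[of star] assms(1) body that
    by (simp add: covariant_operation_def)
  note equiv = given_by_support_iff_M_sum[of _ star, OF _ _ body]
  note cov = given_by_support_imp_covariant[of star, OF body]
  note unique = given_by_support_unique[of _ star]
  \<comment> \<open>Uniqueness for M-addition is carried over from the support function form through
    the equivalence.\<close>
  have unique': "M = N" if "M \<in> convex_bodies" "unconditional M" "given_by_M_sum star M"
    "N \<in> convex_bodies" "unconditional N" "given_by_M_sum star N" for M N
    using unique that equiv by metis
  show ?thesis
  proof (intro conjI impI)
    show supp: "projection_covariant star \<longleftrightarrow>
        (\<exists>M\<in>convex_bodies. unconditional M \<and> given_by_support star M)"
      using ex cov by blast
    show "\<forall>M\<in>convex_bodies. unconditional M \<longrightarrow>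
        (given_by_support star M \<longleftrightarrow> given_by_M_sum star M)"
      using equiv by blast
    then show "projection_covariant star \<longleftrightarrow>
        (\<exists>M\<in>convex_bodies. unconditional M \<and> given_by_M_sum star M)"
      using supp by blast
    assume "projection_covariant star"
    from ex[OF this] obtain M where
      M: "M \<in> convex_bodies" "unconditional M" "given_by_support star M" by blast
    then show "\<exists>!M. M \<in> convex_bodies \<and> unconditional M \<and> given_by_support star M"
      using unique by blast
    from M have "given_by_M_sum star M" using equiv by blast
    then show "\<exists>!M. M \<in> convex_bodies \<and> unconditional M \<and> given_by_M_sum star M"
      using M unique' by blast
  qed
qed

end
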